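(* Let $r>0$ and let the improvement set be the closed ball of radius $r$, $\Delta(x)=\{x'\in\mathbb{R}: |x-x'|\le r\}$. Let $\mathcal{D}$ be the uniform distribution on $[0,1]$ and let $t^*\in[0,1]$. There is a universal constant $C$ such that for any $\epsilon,\delta\in(0,1/2)$, if $S$ consists of $m\ge \frac{C}{\epsilon}\log\frac1\delta$ i.i.d. examples from $\mathcal{D}$ labeled by $h_{t^*}$ (i.e. with sample complexity $M=O(\frac1\epsilon\log\frac1\delta)$), then with probability at least $1-\delta$, $$\mathrm{Loss}_{\mathcal{D}}(h_{S^+},h_{t^*})\le(\epsilon-r)_+ .$$
   Context: $(a)_+=\max\{a,0\}$. Thresholds: for $t\in\mathbb{R}$, $h_t(x)=\mathbb{I}\{x\ge t\}$ on $\mathbb{R}$. For a labeled sample $S=\{(x_i,y_i)\}_{i=1}^m$ with $y_i=h_{t^*}(x_i)$, let $S^+=\{x_i\in S: y_i=1\}$, let $t_{S^+}=\min(S^+)$ if $S^+\neq\emptyset$ and $t_{S^+}=1$ if $S^+=\emptyset$, and let $h_{S^+}(x)=\mathbb{I}\{x\ge t_{S^+}\}$. For a classifier $h$ with values in $\{0,1\}$ the reaction set of $x$ is: $\Delta_h(x)=\{x\}$ if $h(x)=1$; $\Delta_h(x)=\{x\}$ if $\{x'\in\Delta(x): h(x')=1\}=\emptyset$; and $\Delta_h(x)=\{x'\in\Delta(x):h(x')=1\}$ otherwise. For a target $f^*$, $\mathrm{Loss}(x;h,f^* )=\max_{x'\in\Delta_h(x)}\mathbb{I}[h(x')\neq f^*(x')]$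 and $\mathrm{Loss}_{\mathcal{D}}(h,f^* )=\mathbb{P}_{x\sim\mathcal{D}}[\mathrm{Loss}(x;h,f^* )=1]$. *)

theory Defs
  imports "HOL-Probability.Probability"
begin

definition threshold :: "real \<Rightarrow> real \<Rightarrow> nat" where
  "threshold t x = of_bool (t \<le> x)"

definition improvement_ball :: "real \<Rightarrow> real \<Rightarrow> real set" where
  "improvement_ball r x = {x'. \<bar>x - x'\<bar> \<le> r}"

definition reaction_set :: "('a \<Rightarrow> 'a set) \<Rightarrow> ('a \<Rightarrow> nat) \<Rightarrow> 'a \<Rightarrow> 'a set" where
  "reaction_set \<Delta> h x =
     (if h x = 1 then {x}
      else if {x' \<in> \<Delta> x. h x' = 1} = {} then {x}
      else {x' \<in> \<Delta> x. h x' = 1})"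

text \<open>The reaction set may be infinite, but it is never empty and the values range over
  \<open>{0, 1}\<close>, so \<^const>\<open>Max\<close> is applied to a finite nonempty set.\<close>

definition loss :: "('a \<Rightarrow> 'a set) \<Rightarrow> 'a \<Rightarrow> ('a \<Rightarrow> nat) \<Rightarrow> ('a \<Rightarrow> nat) \<Rightarrow> nat" where
  "loss \<Delta> x h f = Max ((\<lambda>x'. of_bool (h x' \<noteq> f x')) ` reaction_set \<Delta> h x)"

definition population_loss ::
    "'a measure \<Rightarrow> ('a \<Rightarrow> 'a set) \<Rightarrow> ('a \<Rightarrow> nat) \<Rightarrow> ('a \<Rightarrow> nat) \<Rightarrow> real" where
  "population_loss D \<Delta> h f = measure D {x \<in> space D. loss \<Delta> x h f = 1}"

definition labeled_sample :: "('a \<Rightarrow> nat) \<Rightarrow> nat \<Rightarrow> (nat \<Rightarrow> 'a) \<Rightarrow> ('a \<times> nat) set" where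
  "labeled_sample f m xs = (\<lambda>i. (xs i, f (xs i))) ` {..<m}"

definition positives :: "('a \<times> nat) set \<Rightarrow> 'a set" where
  "positives S = {x. (x, 1) \<in> S}"

definition learned_threshold :: "(real \<times> nat) set \<Rightarrow> real" where
  "learned_threshold S = (if positives S = {} then 1 else Min (positives S))"

definition uniform01 :: "real measure" where
  "uniform01 = uniform_measure lborel {0..1}"

definition iid :: "'a measure \<Rightarrow> nat \<Rightarrow> (nat \<Rightarrow> 'a) measure" where
  "iid D m = Pi\<^sub>M {..<m} (\<lambda>_. D)"

end

theory Submission
  imports Defs
begin

text \<open>A learned threshold \<open>T \<ge> t\<close> errs exactly on the points of \<open>[t, T - r)\<close>: those within \<open>r\<close> of
  \<open>T\<close> can move to a point that is accepted by both thresholds. Hence the loss is at most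
  \<open>(\<epsilon> - r)\<^sub>+\<close> as soon as \<open>T \<le> t + \<epsilon>\<close>. This fails only if no sample falls into \<open>[t, t + \<epsilon>]\<close>,
  an event of probability \<open>(1 - \<epsilon>)\<^sup>m \<le> exp (- \<epsilon> m) \<le> \<delta>\<close> when \<open>t + \<epsilon> \<le> 1\<close>, and almost never if
  \<open>t + \<epsilon> > 1\<close>, since then \<open>T \<le> 1\<close> almost surely. The constant is \<open>C = 1\<close>.\<close>

text \<open>Phrased with \<open>Suc 0\<close> because simp rewrites \<open>1 :: nat\<close> to it;
  the flipped form arises from membership in the image \<open>labeled_sample\<close>.\<close>

lemma threshold_eq_Suc_0_iff [simp]:
  "threshold t x = Suc 0 \<longleftrightarrow> t \<le> x" "Suc 0 = threshold t x \<longleftrightarrow> t \<le> x"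
  by (auto simp: threshold_def of_bool_def)

lemma loss_threshold_eq_1_iff:
  assumes "0 \<le> r" "t \<le> T"
  shows "loss (improvement_ball r) x (threshold T) (threshold t) = 1 \<longleftrightarrow> t \<le> x \<and> x < T - r"
proof -
  let ?R = "reaction_set (improvement_ball r) (threshold T) x"
  show ?thesis
  proof (cases "x < T - r")
    case True
    then have "?R = {x}"
      using assms by (auto simp: reaction_set_def improvement_ball_def)
    then show ?thesis
      using True assms by (auto simp: loss_def threshold_def)
  next
    case False
    have "?R \<noteq> {}"
      by (auto simp: reaction_set_def)
    \<comment> \<open>If \<open>x < T\<close>, then \<open>T\<close> itself is within reach, so
      every reaction is an accepted point; otherwise \<open>x\<close> is accepted and stays.\<close>
    moreover have "T \<le> y" if "y \<in> ?R" for y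
    proof -
      have "T \<in> improvement_ball r x" if "x < T"
        using False that by (auto simp: improvement_ball_def)
      then have "{x' \<in> improvement_ball r x. threshold T x' = 1} \<noteq> {}" if "x < T"
        using that by auto
      then show ?thesis
        using that by (auto simp: reaction_set_def split: if_splits)
    qed
    then have "threshold T y = threshold t y" if "y \<in> ?R" for y
      using that assms(2) order_trans by (fastforce simp: threshold_def)
    \<comment> \<open>Although \<open>?R\<close> may be infinite, its image is a singleton, so
      \<open>Max\<close> can be evaluated.\<close>
    ultimately have "(\<lambda>y. of_bool (threshold T y \<noteq> threshold t y)) ` ?R = {0::nat}"
      by (auto simp: image_iff)
    then show ?thesis
      using False by (simp add: loss_def)
  qed
qed

lemma prob_space_uniform01: "prob_space uniform01"
  unfolding uniform01_def by (rule prob_space_uniform_measure) auto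

lemma sets_uniform01 [measurable_cong, simp]: "sets uniform01 = sets borel"
  by (simp add: uniform01_def)

lemma space_uniform01 [simp]: "space uniform01 = UNIV"
  by (simp add: uniform01_def)

lemma measure_uniform01:
  "A \<in> sets borel \<Longrightarrow> measure uniform01 A = measure lborel ({0..1} \<inter> A)"
  by (simp add: uniform01_def)

text \<open>The error region is cut off at 1, since sample points outside [0, 1], though of
  probability 0, can push \<open>T - r\<close> above 1. The closed form also makes the loss visibly
  measurable in \<open>T\<close>.\<close>

lemma population_loss_threshold:
  assumes "0 \<le> r" "t \<le> T" "0 \<le> t"
  shows "population_loss uniform01 (improvement_ball r) (threshold T) (threshold t)
    = max 0 (min 1 (T - r) - t)"
proof -
  have "population_loss uniform01 (improvement_ball r) (threshold T) (threshold t)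
      = measure lborel ({0..1} \<inter> {t..<T - r})"
    using assms
    by (simp add: population_loss_def loss_threshold_eq_1_iff[simplified] atLeastLessThan_def
        atLeast_def lessThan_def Collect_conj_eq flip: measure_uniform01)
  also have "{0..1} \<inter> {t..<T - r} = (if T - r \<le> 1 then {t..<T - r} else {t..1})"
    using assms by auto
  finally show ?thesis
    using assms by (auto simp: max_def min_def)
qed

lemma positives_labeled_sample:
  "positives (labeled_sample (threshold t) m xs) = {x \<in> xs ` {..<m}. t \<le> x}"
  by (auto simp: positives_def labeled_sample_def)

text \<open>A bound below a finite minimum is a bound below each element. Free of
  \<open>Min\<close>, this form yields measurability, and upper bounds follow by taking the learned
  threshold itself as \<open>a\<close>.\<close>

lemma learned_threshold_ge_iff:
  "a \<le> learned_threshold (labeled_sample (threshold t) m xs) \<longleftrightarrow>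
    (if \<exists>i\<in>{..<m}. t \<le> xs i then \<forall>i\<in>{..<m}. t \<le> xs i \<longrightarrow> a \<le> xs i else a \<le> 1)"
proof -
  have "finite {x \<in> xs ` {..<m}. t \<le> x}"
    by simp
  then show ?thesis
    by (auto simp: learned_threshold_def positives_labeled_sample)
qed

text \<open>Without positive examples the default value 1 is returned, hence the bound on
  \<open>t\<close>.\<close>

lemma learned_threshold_ge:
  "t \<le> 1 \<Longrightarrow> t \<le> learned_threshold (labeled_sample (threshold t) m xs)"
  by (simp add: learned_threshold_ge_iff)

lemma learned_threshold_le:
  assumes "i < m" "t \<le> xs i"
  shows "learned_threshold (labeled_sample (threshold t) m xs) \<le> xs i"
  using assms learned_threshold_ge_iff[of _ t m xs] by (metis lessThan_iff order_refl)

lemma learned_threshold_le_1: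
  assumes "\<And>i. i < m \<Longrightarrow> xs i \<le> 1"
  shows "learned_threshold (labeled_sample (threshold t) m xs) \<le> 1"
  using assms learned_threshold_ge_iff[of _ t m xs] by (metis lessThan_iff order_refl order_trans)

text \<open>Each set where the learned threshold is at least \<open>a\<close> is a finite Boolean
  combination of conditions on single coordinates.\<close>

lemma measurable_learned_threshold:
  "(\<lambda>xs. learned_threshold (labeled_sample (threshold t) m xs))
    \<in> borel_measurable (iid uniform01 m)"
  unfolding borel_measurable_iff_ge learned_threshold_ge_iff iid_def
proof
  fix a :: real
  have [measurable]: "(\<lambda>xs. xs i) \<in> borel_measurable (Pi\<^sub>M {..<m} (\<lambda>_. uniform01))"
    if "i \<in> {..<m}" for i
    using measurable_component_singleton[OF that, of "\<lambda>_. uniform01"]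
    by (simp cong: measurable_cong_sets)
  show "{xs \<in> space (Pi\<^sub>M {..<m} (\<lambda>_. uniform01)).
      if \<exists>i\<in>{..<m}. t \<le> xs i then \<forall>i\<in>{..<m}. t \<le> xs i \<longrightarrow> a \<le> xs i else a \<le> 1}
    \<in> sets (Pi\<^sub>M {..<m} (\<lambda>_. uniform01))"
    by measurable
qed

lemma prob_space_iid: "prob_space D \<Longrightarrow> prob_space (iid D m)"
  unfolding iid_def by (rule prob_space_PiM)

lemma iid_box:
  assumes "prob_space D" "A \<in> sets D"
  shows "{xs \<in> space (iid D m). \<forall>i<m. xs i \<in> A} \<in> sets (iid D m)"
    and "measure (iid D m) {xs \<in> space (iid D m). \<forall>i<m. xs i \<in> A} = measure D A ^ m"
proof -
  interpret D: prob_space D by fact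
  interpret finite_product_prob_space "\<lambda>_. D" "{..<m}"
    by unfold_locales auto
  have eq: "{xs \<in> space (iid D m). \<forall>i<m. xs i \<in> A} = (\<Pi>\<^sub>E i\<in>{..<m}. A)"
    using sets.sets_into_space[OF assms(2)]
    by (simp add: iid_def space_PiM PiE_iff set_eq_iff Ball_def) blast
  show "{xs \<in> space (iid D m). \<forall>i<m. xs i \<in> A} \<in> sets (iid D m)"
    unfolding eq unfolding iid_def using assms(2) by (intro sets_PiM_I_finite) auto
  show "measure (iid D m) {xs \<in> space (iid D m). \<forall>i<m. xs i \<in> A} = measure D A ^ m"
    unfolding eq unfolding iid_def using assms(2) by (subst prob_times) auto
qed

lemma learned_threshold_close:
  fixes t \<epsilon> \<delta> :: real
  assumes t: "t \<in> {0..1}" and \<epsilon>: "0 < \<epsilon>" and \<delta>: "0 < \<delta>"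
    and m: "1 / \<epsilon> * ln (1 / \<delta>) \<le> real m"
  shows "1 - \<delta> \<le> measure (iid uniform01 m) {xs \<in> space (iid uniform01 m).
    learned_threshold (labeled_sample (threshold t) m xs) \<le> t + \<epsilon>}"
    (is "_ \<le> measure ?P ?E")
proof -
  interpret P: prob_space ?P
    by (intro prob_space_iid prob_space_uniform01)
  have E: "?E \<in> sets ?P"
    using measurable_learned_threshold[of t m] by measurable
  note box = iid_box[OF prob_space_uniform01, simplified]
  show ?thesis
  proof (cases "t + \<epsilon> \<le> 1")
    case True
    \<comment> \<open>The bad event: every sample misses the interval, which lies inside [0, 1] and
      so has mass exactly \<epsilon>.\<close>
    let ?B = "{xs \<in> space ?P. \<forall>i<m. xs i \<in> - {t..t + \<epsilon>}}"
    have "{0..1} \<inter> - {t..t + \<epsilon>} = {0..1} - {t..t + \<epsilon>}"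
      by auto
    moreover have "measure lborel ({0..1} - {t..t + \<epsilon>}) = 1 - \<epsilon>"
      using t \<epsilon> True by (subst measure_Diff) auto
    ultimately have "measure ?P ?B = (1 - \<epsilon>) ^ m"
      by (subst box(2)) (auto simp: measure_uniform01)
    also have "\<dots> \<le> exp (- \<epsilon>) ^ m"
      using t \<epsilon> True exp_ge_add_one_self[of "- \<epsilon>"] by (intro power_mono) auto
    also have "\<dots> = exp (- (\<epsilon> * real m))"
      by (simp add: exp_of_nat_mult[symmetric] mult.commute)
    \<comment> \<open>The sample size gives \<epsilon> m \<ge> ln (1 / \<delta>) = - ln
      \<delta>.\<close>
    also have "\<dots> \<le> exp (ln \<delta>)"
      unfolding exp_le_cancel_iff using m \<epsilon> \<delta> by (simp add: ln_div field_simps)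
    finally have "measure ?P ?B \<le> \<delta>"
      using \<delta> by simp
    moreover have B: "?B \<in> sets ?P"
      by (rule box(1)) auto
    moreover have "space ?P - ?B \<subseteq> ?E"
    proof
      fix xs assume "xs \<in> space ?P - ?B"
      then obtain i where "xs \<in> space ?P" "i < m" "t \<le> xs i" "xs i \<le> t + \<epsilon>"
        by auto
      then show "xs \<in> ?E"
        using learned_threshold_le[of i m t xs] by simp
    qed
    then have "measure ?P (space ?P - ?B) \<le> measure ?P ?E"
      using E by (rule P.finite_measure_mono)
    ultimately show ?thesis
      using P.prob_compl[OF B] by linarith
  next
    case False
    \<comment> \<open>On this almost sure event the learned threshold is at most 1 < t + \<epsilon>,
      also when it takes its default value.\<close>
    let ?A = "{xs \<in> space ?P. \<forall>i<m. xs i \<in> {0..1}}"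
    have "measure ?P ?A = 1"
      by (subst box(2)) (auto simp: measure_uniform01)
    moreover have "?A \<subseteq> ?E"
    proof
      fix xs assume "xs \<in> ?A"
      then show "xs \<in> ?E"
        using False learned_threshold_le_1[of m xs t] by simp
    qed
    then have "measure ?P ?A \<le> measure ?P ?E"
      using E by (rule P.finite_measure_mono)
    ultimately show ?thesis
      using \<delta> by linarith
  qed
qed

theorem theorem4p1:
  shows "\<exists>C::real. C > 0 \<and>
    (\<forall>(r::real) (t::real) (\<epsilon>::real) (\<delta>::real) (m::nat).
       0 < r \<longrightarrow> t \<in> {0..1} \<longrightarrow> \<epsilon> \<in> {0<..<1/2} \<longrightarrow> \<delta> \<in> {0<..<1/2} \<longrightarrow>
       real m \<ge> C / \<epsilon> * ln (1 / \<delta>) \<longrightarrow>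
       measure (iid uniform01 m)
         {xs \<in> space (iid uniform01 m).
            population_loss uniform01 (improvement_ball r)
              (threshold (learned_threshold (labeled_sample (threshold t) m xs)))
              (threshold t)
            \<le> max (\<epsilon> - r) 0}
       \<ge> 1 - \<delta>)"
proof (intro exI[of _ 1] conjI allI impI)
  fix r t \<epsilon> \<delta> :: real and m :: nat
  assume r: "0 < r" and t: "t \<in> {0..1}" and \<epsilon>: "\<epsilon> \<in> {0<..<1/2}" and \<delta>: "\<delta> \<in> {0<..<1/2}"
    and m: "real m \<ge> 1 / \<epsilon> * ln (1 / \<delta>)"
  let ?P = "iid uniform01 m"
  let ?T = "\<lambda>xs. learned_threshold (labeled_sample (threshold t) m xs)"
  let ?G = "{xs \<in> space ?P. population_loss uniform01 (improvement_ball r)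
    (threshold (?T xs)) (threshold t) \<le> max (\<epsilon> - r) 0}"
  interpret P: prob_space ?P
    by (intro prob_space_iid prob_space_uniform01)
  \<comment> \<open>As a function of \<open>?T xs\<close> alone, the loss gives a measurable event,
    as monotonicity of the measure requires.\<close>
  have G: "?G = {xs \<in> space ?P. max 0 (min 1 (?T xs - r) - t) \<le> max (\<epsilon> - r) 0}"
    using r t by (simp add: population_loss_threshold learned_threshold_ge)
  have "?G \<in> sets ?P"
    unfolding G using measurable_learned_threshold[of t m] by measurable
  \<comment> \<open>From \<open>?T xs\<close> \<le> t + \<epsilon> follows \<open>?T xs\<close> - r
    - t \<le> \<epsilon> - r; taking positive parts gives the bound.\<close>
  moreover have "{xs \<in> space ?P. ?T xs \<le> t + \<epsilon>} \<subseteq> ?G"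
    unfolding G by auto
  ultimately show "1 - \<delta> \<le> measure ?P ?G"
    using learned_threshold_close[OF t _ _ m] \<epsilon> \<delta> P.finite_measure_mono
    by (meson greaterThanLessThan_iff order_trans)
qed simp

end
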